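(* Let $p\in[1,+\infty)$, $p\neq d_y/2$. Suppose: (i) there is a constant $a>p$ such that $\mathbb{E}[\exp(\|\varepsilon\|^a)]<+\infty$; (ii) the regression estimate $\hat f_n$ has the following finite sample property: for a.e. $x\in\mathcal{X}$ and any $\alpha\in(0,1)$ there exists a constant $\kappa_{p,n}(\alpha,x)>0$ such that $$\mathbb{P}\{\|f^*(x)-\hat f_n(x)\|^p>\kappa_{p,n}^p(\alpha,x)\}\le\alpha,\qquad \mathbb{P}\Big\{\tfrac1n\sum_{i=1}^n\|f^*(x^i)-\hat f_n(x^i)\|^p>\kappa_{p,n}^p(\alpha,x)\Big\}\le\alpha;$$ (iii) the samples $\{\varepsilon^i\}_{i=1}^n$ are i.i.d. Let $\alpha\in(0,1)$ be a given risk level. Then, for a.e. $x\in\mathcal{X}$, the optimal value $\hat v^{DRO}_n(x)$ and an optimal solution $\hat z^{DRO}_n(x)$ of the Wasserstein ER-DRO problem with ambiguity set $\hat{\mathcal P}_n(x;\zeta_n(\alpha,x))$, with radius $\zeta_n(\alpha,x)$ as defined in the context, satisfy $$\mathbb{P}\big\{g(\hat z^{DRO}_n(x);x)\le \hat v^{DRO}_n(x)\big\}\ge 1-\alpha .$$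
   Context: Setup. $Y=f^*(X)+\varepsilon$, where $X$ is a random vector with support $\mathcal X\subseteq\mathbb R^{d_x}$ and distribution $P_X$, $Y$ has nonempty convex support $\mathcal Y\subseteq\mathbb R^{d_y}$, $f^*(x):=\mathbb E[Y\mid X=x]$, and the zero-mean error $\varepsilon$ (distribution $P_\varepsilon$) is independent of $X$. $P_{Y\mid X=x}$ is the conditional distribution of $Y$ given $X=x$, i.e. the law of $f^*(x)+\varepsilon$. "A.e. $x$" is with respect to $P_X$. $\|\cdot\|$ is the Euclidean norm. $\mathcal Z\subseteq\mathbb R^{d_z}$ is nonempty and compact, $c:\mathcal Z\times\mathcal Y\to\mathbb R$, $\mathbb E|c(z,f^*(x)+\varepsilon)|<\infty$ for each $z\in\mathcal Z$ and a.e. $x$, and $g(z;x):=\mathbb E[c(z,f^*(x)+\varepsilon)]$ (expectation over $\varepsilon\sim P_\varepsilon$) is lower semicontinuous in $z$ on $\mathcal Z$ for a.e. $x$. All functions, sets and selections are assumed measurable. Data. $\mathcal D_n=\{(y^i,x^i)\}_{i=1}^n$ are joint observations of $(Y,X)$, $\varepsilon^i:=y^i-f^*(x^i)$; $\hat f_n$ is an estimate of $f^*$ built from $\mathcal D_n$ by a regression method, with residuals $\hat\varepsilon^i_n:=y^i-\hat f_n(x^i)$. Probabilities $\mathbb P$ refer to the data. With $\mathrm{proj}_{\mathcal Y}$ the orthogonal projection onto $\mathcal Y$ and $\delta$ the Dirac measure, $$P^*_n(x):=\tfrac1n\sum_{i=1}^n\delta_{f^*(x)+\varepsilon^i},\qquad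 \hat P^{ER}_n(x):=\tfrac1n\sum_{i=1}^n\delta_{\mathrm{proj}_{\mathcal Y}(\hat f_n(x)+\hat\varepsilon^i_n)} .$$ Wasserstein ER-DRO. $\mathcal P(\mathcal Y)$ is the set of probability distributions supported in $\mathcal Y$; $d_{W,p}(Q_1,Q_2):=\big(\inf_\pi\int\|y_1-y_2\|^p\,d\pi\big)^{1/p}$, infimum over couplings $\pi$ of $Q_1,Q_2$. For $\zeta\ge0$, $\hat{\mathcal P}_n(x;\zeta):=\{Q\in\mathcal P(\mathcal Y): d_{W,p}(Q,\hat P^{ER}_n(x))\le\zeta\}$. The ER-DRO problem is $\hat v^{DRO}_n(x)=\min_{z\in\mathcal Z}\sup_{Q\in\hat{\mathcal P}_n(x;\zeta)}\mathbb E_{Y\sim Q}[c(z,Y)]$, whose objective is assumed real-valued and lower semicontinuous on $\mathcal Z$ for each $x$; $\hat z^{DRO}_n(x)$ denotes an optimal solution. Radius. Let $C\ge1$, $c_0>0$ be the constants (depending only on $a$, $d_y$ and $\mathbb E[\exp(\|\varepsilon\|^a)]$) of the measure concentration inequality, quoted from the literature, $$\mathbb P\{d_{W,p}(P^*_n(x),P_{Y\mid X=x})\ge\kappa\}\le\begin{cases}C\exp(-c_0n\kappa^{\max\{d_y/p,2\}}),&\kappa\le1,\\ C\exp(-c_0n\kappa^{a/p}),&\kappa>1,\end{cases}$$ for all $\kappa>0$, $n\in\mathbb N$, $x\in\mathcal X$. Setting the right-hand side equal to $\alpha/2$ gives $$\kappa^{(2)}_{p,n}(\alpha):=\begin{cases}\big(\tfrac{\log(2C/\alpha)}{c_0n}\big)^{\min\{p/d_y,1/2\}},&n\ge\log(2C/\alpha)/c_0,\\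 \big(\tfrac{\log(2C/\alpha)}{c_0n}\big)^{p/a},&n<\log(2C/\alpha)/c_0.\end{cases}$$ The radius is $\zeta_n(\alpha,x):=2\kappa_{p,n}(\alpha/4,x)+\kappa^{(2)}_{p,n}(\alpha)$. *)

theory Defs
  imports "HOL-Probability.Probability"
begin

definition msupport :: "'a::topological_space measure \<Rightarrow> 'a set" where
  "msupport \<mu> = {x. \<forall>U. open U \<longrightarrow> x \<in> U \<longrightarrow> emeasure \<mu> U \<noteq> 0}"

definition lsc_on :: "'a::topological_space set \<Rightarrow> ('a \<Rightarrow> 'b::linorder_topology) \<Rightarrow> bool" where
  "lsc_on S f \<longleftrightarrow> (\<forall>x\<in>S. \<forall>r. r < f x \<longrightarrow> (\<forall>\<^sub>F y in at x within S. r < f y))"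

text \<open>The law of \<open>f x + \<epsilon>\<close> for \<open>\<epsilon>\<close> distributed as \<open>P\<close>. If \<open>\<epsilon>\<close> is independent of \<open>X\<close>, this is the
  conditional distribution of \<open>f X + \<epsilon>\<close> given \<open>X = x\<close>; the lemma below shows that its mean is
  \<open>f x\<close>, so a regression function \<open>f\<close> satisfies \<open>f x = E[Y | X = x]\<close>.\<close>

definition cond_law :: "'y::euclidean_space measure \<Rightarrow> ('x \<Rightarrow> 'y) \<Rightarrow> 'x \<Rightarrow> 'y measure" where
  "cond_law P f x = distr P borel (\<lambda>e. f x + e)"

lemma integral_cond_law:
  fixes P :: "'y::euclidean_space measure"
  assumes "prob_space P" "sets P = sets borel" "integrable P (\<lambda>e. e)" "(\<integral>e. e \<partial>P) = 0"
  shows "(\<integral>y. y \<partial>cond_law P f x) = f x"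
proof -
  interpret prob_space P by fact
  have [measurable_cong]: "sets P = sets borel" by fact
  have "(\<integral>y. y \<partial>cond_law P f x) = (\<integral>e. f x + e \<partial>P)"
    unfolding cond_law_def by (subst integral_distr) auto
  also have "\<dots> = f x"
    using assms(3,4) by (simp add: prob_space)
  finally show ?thesis .
qed

text \<open>\<open>(1/n) \<Sum>\<^sub>i \<delta>\<^bsub>v i\<^esub>\<close> over \<open>i = 1, \<dots>, n\<close>, for \<open>n \<ge> 1\<close>.\<close>

definition empirical :: "nat \<Rightarrow> (nat \<Rightarrow> 'y::euclidean_space) \<Rightarrow> 'y measure" where
  "empirical n v = distr (uniform_count_measure {1..n}) borel v"

lemma emeasure_empirical:
  assumes "A \<in> sets borel" "n \<ge> 1"
  shows "emeasure (empirical n v) A = ennreal ((\<Sum>i=1..n. indicator A (v i)) / real n)"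
proof -
  have "(\<Sum>i=1..n. indicator A (v i)) = real (card (v -` A \<inter> {1..n}))"
    by (simp add: indicator_def sum.If_cases vimage_def Int_def conj_commute)
  then show ?thesis
    using assms unfolding empirical_def
    by (subst emeasure_distr)
      (auto simp: measurable_def sets_uniform_count_measure space_uniform_count_measure
        emeasure_uniform_count_measure)
qed

definition couplings :: "'y::euclidean_space measure \<Rightarrow> 'y measure \<Rightarrow> ('y \<times> 'y) measure set" where
  "couplings P Q = {\<pi>. prob_space \<pi> \<and> sets \<pi> = sets (borel \<Otimes>\<^sub>M borel) \<and>
     distr \<pi> borel fst = P \<and> distr \<pi> borel snd = Q}"

text \<open>The distance may be infinite, as no moment condition is imposed on the arguments.\<close>

definition wasserstein :: "real \<Rightarrow> 'y::euclidean_space measure \<Rightarrow> 'y measure \<Rightarrow> ennreal" where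
  "wasserstein p P Q =
     (let m = (INF \<pi>\<in>couplings P Q. \<integral>\<^sup>+ (y1, y2). ennreal (norm (y1 - y2) powr p) \<partial>\<pi>)
      in if m = \<infinity> then \<infinity> else ennreal (enn2real m powr (1 / p)))"

definition probs_on :: "'y::euclidean_space set \<Rightarrow> 'y measure set" where
  "probs_on S = {Q. prob_space Q \<and> sets Q = sets borel \<and> emeasure Q S = 1}"

definition wasserstein_ball ::
    "real \<Rightarrow> 'y::euclidean_space set \<Rightarrow> 'y measure \<Rightarrow> real \<Rightarrow> 'y measure set" where
  "wasserstein_ball p S P \<zeta> = {Q \<in> probs_on S. wasserstein p Q P \<le> ennreal \<zeta>}"

text \<open>Expectation with values in the extended reals. If the positive and the negative part both have
  infinite integral, the value is \<open>\<infinity> - \<infinity> = \<infinity>\<close> in \<^typ>\<open>ereal\<close>; so a supremum of such expectations that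
  is finite ranges over well-defined ones only. The Bochner integral would instead be \<open>0\<close> for every
  non-integrable function, and could lower the supremum or hide that it is infinite.\<close>

definition ext_expectation :: "'y measure \<Rightarrow> ('y \<Rightarrow> real) \<Rightarrow> ereal" where
  "ext_expectation Q h =
     enn2ereal (\<integral>\<^sup>+ y. ennreal (h y) \<partial>Q) - enn2ereal (\<integral>\<^sup>+ y. ennreal (- h y) \<partial>Q)"

definition dro_objective ::
    "real \<Rightarrow> 'y::euclidean_space set \<Rightarrow> ('z \<Rightarrow> 'y \<Rightarrow> real) \<Rightarrow> 'y measure \<Rightarrow> real \<Rightarrow> 'z \<Rightarrow> ereal" where
  "dro_objective p S c P \<zeta> z = (SUP Q\<in>wasserstein_ball p S P \<zeta>. ext_expectation Q (c z))"

definition dro_value ::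
    "real \<Rightarrow> 'y::euclidean_space set \<Rightarrow> ('z \<Rightarrow> 'y \<Rightarrow> real) \<Rightarrow> 'z set \<Rightarrow> 'y measure \<Rightarrow> real \<Rightarrow> ereal" where
  "dro_value p S c Z P \<zeta> = (INF z\<in>Z. dro_objective p S c P \<zeta> z)"

definition is_dro_solution ::
    "real \<Rightarrow> 'y::euclidean_space set \<Rightarrow> ('z \<Rightarrow> 'y \<Rightarrow> real) \<Rightarrow> 'z set \<Rightarrow> 'y measure \<Rightarrow> real \<Rightarrow> 'z \<Rightarrow> bool" where
  "is_dro_solution p S c Z P \<zeta> z \<longleftrightarrow>
     z \<in> Z \<and> (\<forall>z'\<in>Z. dro_objective p S c P \<zeta> z \<le> dro_objective p S c P \<zeta> z')"

text \<open>The right-hand side of the concentration inequality for dimension \<open>d\<close>, and the value of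
  \<open>\<kappa>\<close> at which it equals \<open>\<alpha> / 2\<close>.\<close>

definition conc_bound :: "real \<Rightarrow> real \<Rightarrow> nat \<Rightarrow> real \<Rightarrow> real \<Rightarrow> nat \<Rightarrow> real \<Rightarrow> real" where
  "conc_bound p a d C c\<^sub>0 n \<kappa> =
     (if \<kappa> \<le> 1 then C * exp (- c\<^sub>0 * real n * \<kappa> powr max (real d / p) 2)
      else C * exp (- c\<^sub>0 * real n * \<kappa> powr (a / p)))"

definition kappa2 :: "real \<Rightarrow> real \<Rightarrow> nat \<Rightarrow> real \<Rightarrow> real \<Rightarrow> nat \<Rightarrow> real \<Rightarrow> real" where
  "kappa2 p a d C c\<^sub>0 n \<alpha> =
     (if real n \<ge> ln (2 * C / \<alpha>) / c\<^sub>0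
      then (ln (2 * C / \<alpha>) / (c\<^sub>0 * real n)) powr min (p / real d) (1 / 2)
      else (ln (2 * C / \<alpha>) / (c\<^sub>0 * real n)) powr (p / a))"

end

theory Submission
  imports Defs
begin

text \<open>It suffices that, with probability at least \<open>1 - \<alpha>\<close>, the law \<open>Q\<close> of \<open>f\<^sup>*(x) + \<epsilon>\<close> lies in the
  Wasserstein ball, since the worst-case expectation then dominates \<open>g(z; x)\<close> for every \<open>z\<close>. Outside an
  event of probability \<open>\<alpha>/2\<close> some coupling of \<open>P\<^sup>*\<^sub>n(x)\<close> and \<open>Q\<close> has cost below \<open>\<kappa>\<^sup>(\<^sup>2\<^sup>)\<close>. Lifted to
  the sample index, it induces a coupling of \<open>Q\<close> with the residual-based empirical distribution; the
  additional transport is bounded by \<open>2\<kappa>\<close> outside two events of probability \<open>\<alpha>/4\<close>, because the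
  projection onto \<open>\<Y>\<close> is nonexpansive and fixes the points \<open>f\<^sup>*(x) + \<epsilon>\<^sup>i\<close>. The latter lie in
  \<open>\<Y>\<close> almost surely, for almost every \<open>x\<close>, by Fubini.\<close>

section \<open>Minkowski's inequality for nonnegative functions\<close>

text \<open>Convexity of \<open>t \<mapsto> t\<^sup>p\<close> at the points \<open>a/A\<close>, \<open>b/B\<close>. Integrated, it gives Minkowski's
  inequality for functions with \<open>L\<^sup>p\<close> norms at most \<open>A\<close> and \<open>B\<close>.\<close>

lemma powr_add_le_convex_combination:
  fixes a b A B p :: real
  assumes "p \<ge> 1" "0 \<le> a" "0 \<le> b" "0 < A" "0 < B"
  shows "(a + b) powr p \<le>
    (A + B) powr p * (A / (A + B) * (a powr p / A powr p) + B / (A + B) * (b powr p / B powr p))"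
proof -
  \<comment> \<open>Convexity is applied below only at strictly positive points. If one argument
    vanishes, this bound settles the claim: a ratio \<open>Y / (A + B)\<close> of at most 1 does not
    grow when raised to a power \<open>p \<ge> 1\<close>.\<close>
  have shrink: "(y / (A + B)) powr p \<le> Y / (A + B) * (y powr p / Y powr p)"
    if "0 \<le> y" "0 < Y" "Y \<le> A + B" for y Y
  proof -
    have "(Y / (A + B)) powr p \<le> (Y / (A + B)) powr 1"
      using that assms by (intro powr_mono') auto
    then have "(Y / (A + B)) powr p * (y / Y) powr p \<le> Y / (A + B) * (y / Y) powr p"
      using that assms by (intro mult_right_mono) auto
    moreover have "(Y / (A + B)) powr p * (y / Y) powr p = (y / (A + B)) powr p"
      using that assms by (subst powr_mult [symmetric]) auto
    ultimately show ?thesis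
      using that by (simp add: powr_divide)
  qed
  have "((a + b) / (A + B)) powr p
      \<le> A / (A + B) * (a powr p / A powr p) + B / (A + B) * (b powr p / B powr p)"
  proof (cases "a = 0 \<or> b = 0")
    case True
    then show ?thesis
      using assms shrink[of b B] shrink[of a A] by auto
  next
    case False
    define t where "t = B / (A + B)"
    have t: "0 \<le> t" "t \<le> 1" "1 - t = A / (A + B)"
      using assms by (auto simp: t_def field_simps)
    have "((1 - t) *\<^sub>R (a / A) + t *\<^sub>R (b / B)) powr p
        \<le> (1 - t) * (a / A) powr p + t * (b / B) powr p"
      using False assms t by (intro convex_onD[OF powr_convex]) auto
    moreover have "(1 - t) *\<^sub>R (a / A) + t *\<^sub>R (b / B) = (a + b) / (A + B)"
      using assms unfolding t(3) by (simp add: t_def add_divide_distrib)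
    ultimately show ?thesis
      using assms unfolding t(3) by (simp add: t_def powr_divide)
  qed
  then have "(A + B) powr p * ((a + b) / (A + B)) powr p \<le> (A + B) powr p *
      (A / (A + B) * (a powr p / A powr p) + B / (A + B) * (b powr p / B powr p))"
    by (rule mult_left_mono) auto
  moreover have "(A + B) powr p * ((a + b) / (A + B)) powr p = (a + b) powr p"
    using assms by (simp add: powr_divide)
  ultimately show ?thesis by simp
qed

text \<open>\<open>A\<close> and \<open>B\<close> are positive bounds rather than the norms
  themselves, so dividing by \<open>A powr p\<close> and \<open>B powr p\<close> is safe even for
  functions of norm zero. The weights \<open>A / (A + B)\<close> and \<open>B / (A + B)\<close> add
  up to 1, which makes the integrated bound exactly \<open>(A + B) powr p\<close>.\<close>

lemma nn_integral_Minkowski: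
  fixes f g :: "'a \<Rightarrow> real"
  assumes p: "p \<ge> 1" and AB: "0 < A" "0 < B"
    and [measurable]: "f \<in> borel_measurable M" "g \<in> borel_measurable M"
    and pos: "\<And>x. 0 \<le> f x" "\<And>x. 0 \<le> g x"
    and f: "(\<integral>\<^sup>+x. ennreal (f x powr p) \<partial>M) \<le> ennreal (A powr p)"
    and g: "(\<integral>\<^sup>+x. ennreal (g x powr p) \<partial>M) \<le> ennreal (B powr p)"
  shows "(\<integral>\<^sup>+x. ennreal ((f x + g x) powr p) \<partial>M) \<le> ennreal ((A + B) powr p)"
proof -
  define K where "K = (A + B) powr p"
  define s where "s = K * (A / (A + B) / A powr p)"
  define t where "t = K * (B / (A + B) / B powr p)"
  have st: "0 \<le> s" "0 \<le> t"
    using AB by (auto simp: s_def t_def K_def)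
  have "ennreal ((f x + g x) powr p) \<le> ennreal s * ennreal (f x powr p) + ennreal t * ennreal (g x powr p)" for x
  proof -
    have "(f x + g x) powr p \<le> s * f x powr p + t * g x powr p"
      using powr_add_le_convex_combination[OF p pos(1)[of x] pos(2)[of x] AB]
      by (simp add: s_def t_def K_def algebra_simps)
    then show ?thesis
      using st by (simp add: ennreal_plus[symmetric] ennreal_mult[symmetric] del: ennreal_plus)
  qed
  then have "(\<integral>\<^sup>+x. ennreal ((f x + g x) powr p) \<partial>M)
      \<le> (\<integral>\<^sup>+x. ennreal s * ennreal (f x powr p) + ennreal t * ennreal (g x powr p) \<partial>M)"
    by (intro nn_integral_mono)
  also have "\<dots> = ennreal s * (\<integral>\<^sup>+x. ennreal (f x powr p) \<partial>M) + ennreal t * (\<integral>\<^sup>+x. ennreal (g x powr p) \<partial>M)"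
    by (simp add: nn_integral_add nn_integral_cmult)
  also have "\<dots> \<le> ennreal s * ennreal (A powr p) + ennreal t * ennreal (B powr p)"
    by (intro add_mono mult_left_mono f g) auto
  also have "\<dots> = ennreal (s * A powr p + t * B powr p)"
    using st by (simp add: ennreal_plus ennreal_mult)
  also have "s * A powr p + t * B powr p = K * (A / (A + B) + B / (A + B))"
  proof -
    have "s * A powr p = K * (A / (A + B))" "t * B powr p = K * (B / (A + B))"
      using AB by (simp_all add: s_def t_def)
    then show ?thesis by (simp add: distrib_left)
  qed
  also have "\<dots> = K"
    using AB by (simp add: add_divide_distrib[symmetric])
  finally show ?thesis by (simp add: K_def)
qed

section \<open>The support of a measure\<close>

lemma Compl_msupport:
  "- msupport \<mu> = \<Union>{U. open U \<and> emeasure \<mu> U = 0}"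
  by (auto simp: msupport_def)

lemma closed_msupport: "closed (msupport \<mu>)"
  unfolding closed_def Compl_msupport by auto

text \<open>The complement of the support is a union of open null sets; by the Lindelof property
  countably many of them already cover it.\<close>

lemma AE_in_msupport:
  fixes \<mu> :: "'a::second_countable_topology measure"
  assumes "sets \<mu> = sets borel"
  shows "AE x in \<mu>. x \<in> msupport \<mu>"
proof -
  obtain \<F> where \<F>: "\<F> \<subseteq> {U. open U \<and> emeasure \<mu> U = 0}" "countable \<F>"
      "\<Union>\<F> = - msupport \<mu>"
    using Lindelof[of "{U. open U \<and> emeasure \<mu> U = 0}"] unfolding Compl_msupport by blast
  have "(\<Union>U\<in>\<F>. U) \<in> null_sets \<mu>"
    using \<F> assms by (intro null_sets_UN') (auto simp: null_sets_def)
  then show ?thesis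
    using \<F>(3) by (intro AE_I'[of "\<Union>\<F>"]) auto
qed

section \<open>Uniform measures on the sample index, and couplings lifted to it\<close>

lemma nn_integral_uniform_count_measure:
  fixes f :: "'a \<Rightarrow> ennreal"
  assumes "finite A"
  shows "(\<integral>\<^sup>+x. f x \<partial>uniform_count_measure A) = (\<Sum>x\<in>A. f x * ennreal (1 / card A))"
  using assms unfolding uniform_count_measure_def
  by (subst nn_integral_point_measure_finite) (auto simp: mult.commute)

lemma nn_integral_uniform_count_measure_ennreal:
  assumes "finite A" "\<And>x. x \<in> A \<Longrightarrow> 0 \<le> f x"
  shows "(\<integral>\<^sup>+x. ennreal (f x) \<partial>uniform_count_measure A) = ennreal (sum f A / card A)"
  using assms
  by (simp add: nn_integral_uniform_count_measure ennreal_mult[symmetric] sum_divide_distrib)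

text \<open>The points \<open>v i\<close> may coincide, so the index is not a function of the point: mass at \<open>y\<close> is split
  evenly among the indices \<open>i\<close> with \<open>v i = y\<close>.\<close>

lemma coupling_empirical_index:
  fixes v :: "nat \<Rightarrow> 'y::euclidean_space"
  assumes n: "n \<ge> 1" and \<pi>: "\<pi> \<in> couplings (empirical n v) Q"
  obtains \<rho> where "prob_space \<rho>" "sets \<rho> = sets (count_space {1..n} \<Otimes>\<^sub>M borel)"
    "distr \<rho> (count_space {1..n}) fst = uniform_count_measure {1..n}"
    "distr \<rho> (borel \<Otimes>\<^sub>M borel) (\<lambda>(i, y). (v i, y)) = \<pi>"
proof -
  interpret \<pi>: prob_space \<pi> using \<pi> by (simp add: couplings_def)
  have [measurable_cong]: "sets \<pi> = sets (borel \<Otimes>\<^sub>M borel)"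
    and fst\<pi>: "distr \<pi> borel fst = empirical n v"
    using \<pi> by (auto simp: couplings_def)
  define I where "I = {1..n}"
  have I: "finite I" "I \<noteq> {}" "card I = n" using n by (auto simp: I_def)
  define N where "N y = card {i\<in>I. v i = y}" for y
  define w where "w i y = (if y = v i then ennreal (1 / N y) else 0)" for i y
  have [measurable]: "(\<lambda>y. w i y) \<in> borel_measurable borel" for i
  proof -
    \<comment> \<open>The weight vanishes unless \<open>y = v i\<close>, so \<open>N y\<close> may
      be replaced with the constant \<open>N (v i)\<close>; what remains is a case distinction at a
      single point.\<close>
    have "(\<lambda>y. w i y) = (\<lambda>y. if y = v i then ennreal (1 / N (v i)) else 0)"
      by (auto simp: w_def)
    then show ?thesis by simp
  qed
  have [measurable]: "v \<in> count_space I \<rightarrow>\<^sub>M borel" by simp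
  \<comment> \<open>\<open>\<tau>\<close> lives on triples of an index and the two points of
    \<open>\<pi>\<close>, with \<open>w\<close> as the conditional law of the index given the first
    point. Forgetting that point in \<open>\<rho>\<close> loses nothing, since it equals
    \<open>v i\<close> almost everywhere.\<close>
  define \<tau> where "\<tau> = density (count_space I \<Otimes>\<^sub>M \<pi>) (\<lambda>(i, y, _). w i y)"
  define \<rho> where "\<rho> = distr \<tau> (count_space I \<Otimes>\<^sub>M borel) (\<lambda>(i, _, y). (i, y))"
  have w_meas: "(\<lambda>(i, y, _). w i y) \<in> borel_measurable (count_space I \<Otimes>\<^sub>M \<pi>)"
    using I by (intro measurable_pair_measure_countable1) (auto intro: countable_finite)
  have wh_meas: "(\<lambda>(i, y1, y2). w i y1 * h (i, y2)) \<in> borel_measurable (count_space I \<Otimes>\<^sub>M \<pi>)"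
    if [measurable]: "h \<in> borel_measurable (count_space I \<Otimes>\<^sub>M borel)" for h
    using I by (intro measurable_pair_measure_countable1) (auto intro: countable_finite)
  \<comment> \<open>Both pushforward identities for \<open>\<rho>\<close> follow from this formula
    by a choice of \<open>h\<close>.\<close>
  have nn_\<rho>: "(\<integral>\<^sup>+z. h z \<partial>\<rho>) = (\<Sum>i\<in>I. \<integral>\<^sup>+(y1, y2). w i y1 * h (i, y2) \<partial>\<pi>)"
    if [measurable]: "h \<in> borel_measurable (count_space I \<Otimes>\<^sub>M borel)" for h
  proof -
    have "(\<integral>\<^sup>+z. h z \<partial>\<rho>) = (\<integral>\<^sup>+(i, y1, y2). h (i, y2) \<partial>\<tau>)"
      unfolding \<rho>_def by (subst nn_integral_distr) (auto simp: \<tau>_def split_beta')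
    also have "\<dots> = (\<integral>\<^sup>+(i, y1, y2). w i y1 * h (i, y2) \<partial>(count_space I \<Otimes>\<^sub>M \<pi>))"
      unfolding \<tau>_def using w_meas by (subst nn_integral_density) (auto simp: split_beta')
    also have "\<dots> = (\<integral>\<^sup>+i. (\<integral>\<^sup>+(y1, y2). w i y1 * h (i, y2) \<partial>\<pi>) \<partial>count_space I)"
      using wh_meas[OF that] by (subst \<pi>.nn_integral_fst[symmetric]) (auto simp: split_beta')
    also have "\<dots> = (\<Sum>i\<in>I. \<integral>\<^sup>+(y1, y2). w i y1 * h (i, y2) \<partial>\<pi>)"
      using I by (simp add: nn_integral_count_space_finite)
    finally show ?thesis .
  qed
  have sets\<rho>: "sets \<rho> = sets (count_space I \<Otimes>\<^sub>M borel)"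
    by (simp add: \<rho>_def)
  note [measurable_cong] = sets\<rho>
  have N_pos: "N (v i) > 0" if "i \<in> I" for i
    using that I by (auto simp: N_def card_gt_0_iff)
  \<comment> \<open>Under the empirical law the point \<open>v i\<close> has mass
    \<open>N (v i) / n\<close>, and \<open>w\<close> hands each of its \<open>N (v i)\<close>
    indices an equal share.\<close>
  have P: "(\<integral>\<^sup>+(y1, y2). w i y1 \<partial>\<pi>) = ennreal (1 / n)" if i: "i \<in> I" for i
  proof -
    have "(\<integral>\<^sup>+(y1, y2). w i y1 \<partial>\<pi>) = (\<integral>\<^sup>+y. w i y \<partial>empirical n v)"
      unfolding fst\<pi>[symmetric] by (subst nn_integral_distr) (auto simp: split_beta')
    also have "\<dots> = (\<Sum>j\<in>I. w i (v j) * ennreal (1 / card I))"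
      unfolding empirical_def I_def[symmetric]
      by (subst nn_integral_distr) (auto simp: nn_integral_uniform_count_measure I)
    also have "\<dots> = (\<Sum>j\<in>{j\<in>I. v j = v i}. ennreal (1 / N (v i)) * ennreal (1 / n))"
      using I by (intro sum.mono_neutral_cong_right) (auto simp: w_def)
    also have "\<dots> = of_nat (N (v i)) * (ennreal (1 / N (v i)) * ennreal (1 / n))"
      by (simp add: N_def)
    also have "\<dots> = ennreal (1 / n)"
      using N_pos[OF i]
      by (simp add: ennreal_of_nat_eq_real_of_nat ennreal_mult[symmetric] mult.assoc[symmetric])
    finally show ?thesis .
  qed
  have fst\<rho>: "distr \<rho> (count_space I) fst = uniform_count_measure I"
  proof (rule measure_eqI)
    fix A assume "A \<in> sets (distr \<rho> (count_space I) fst)"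
    then have A: "A \<subseteq> I" by simp
    then have [measurable]: "A \<in> sets (count_space I)" by simp
    have "emeasure (distr \<rho> (count_space I) fst) A = (\<integral>\<^sup>+z. indicator A z \<partial>distr \<rho> (count_space I) fst)"
      using A by (subst nn_integral_indicator) auto
    also have "\<dots> = (\<integral>\<^sup>+z. indicator A (fst z) \<partial>\<rho>)"
      by (subst nn_integral_distr) auto
    also have "\<dots> = (\<Sum>i\<in>I. \<integral>\<^sup>+(y1, y2). w i y1 * indicator A i \<partial>\<pi>)"
      by (subst nn_\<rho>) auto
    also have "\<dots> = (\<Sum>i\<in>I. ennreal (1 / n) * indicator A i)"
      using P unfolding split_beta' by (intro sum.cong refl) (simp add: nn_integral_multc)
    also have "\<dots> = (\<integral>\<^sup>+z. indicator A z \<partial>uniform_count_measure I)"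
      by (simp only: nn_integral_uniform_count_measure[OF I(1)] I mult.commute)
    also have "\<dots> = emeasure (uniform_count_measure I) A"
      using A by (subst nn_integral_indicator) (auto simp: sets_uniform_count_measure)
    finally show "emeasure (distr \<rho> (count_space I) fst) A = emeasure (uniform_count_measure I) A" .
  qed (simp add: sets_uniform_count_measure)
  have [measurable]: "v ` I \<in> sets borel"
    using I by (intro borel_closed finite_imp_closed) auto
  \<comment> \<open>Off the sample points all weights vanish, so they sum to 1 only almost
    everywhere.\<close>
  have "AE y in empirical n v. y \<in> v ` I"
    unfolding empirical_def I_def[symmetric]
    by (subst AE_distr_iff) (auto simp: space_uniform_count_measure)
  then have AE\<pi>: "AE z in \<pi>. fst z \<in> v ` I"
    unfolding fst\<pi>[symmetric] by (subst (asm) AE_distr_iff) auto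
  have w_sum: "(\<Sum>i\<in>I. w i y) = 1" if y: "y \<in> v ` I" for y
  proof -
    have "(\<Sum>i\<in>I. w i y) = (\<Sum>i\<in>{i\<in>I. v i = y}. ennreal (1 / N y))"
      using I by (intro sum.mono_neutral_cong_right) (auto simp: w_def)
    also have "\<dots> = of_nat (N y) * ennreal (1 / N y)"
      by (simp add: N_def)
    also have "\<dots> = 1"
      using N_pos y by (auto simp: ennreal_of_nat_eq_real_of_nat ennreal_mult[symmetric])
    finally show ?thesis .
  qed
  have map\<rho>: "distr \<rho> (borel \<Otimes>\<^sub>M borel) (\<lambda>(i, y). (v i, y)) = \<pi>"
  proof (rule measure_eqI)
    fix A assume "A \<in> sets (distr \<rho> (borel \<Otimes>\<^sub>M borel) (\<lambda>(i, y). (v i, y)))"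
    then have [measurable]: "A \<in> sets (borel \<Otimes>\<^sub>M borel)" by simp
    have "emeasure (distr \<rho> (borel \<Otimes>\<^sub>M borel) (\<lambda>(i, y). (v i, y))) A
        = (\<integral>\<^sup>+z. indicator A z \<partial>distr \<rho> (borel \<Otimes>\<^sub>M borel) (\<lambda>(i, y). (v i, y)))"
      by (subst nn_integral_indicator) auto
    also have "\<dots> = (\<integral>\<^sup>+(i, y). indicator A (v i, y) \<partial>\<rho>)"
      by (subst nn_integral_distr) (auto simp: split_beta')
    also have "\<dots> = (\<Sum>i\<in>I. \<integral>\<^sup>+(y1, y2). w i y1 * indicator A (v i, y2) \<partial>\<pi>)"
      by (subst nn_\<rho>) auto
    \<comment> \<open>Replacing \<open>v i\<close> with the first coordinate is harmless:
      \<open>w i\<close> is zero wherever the two differ.\<close>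
    also have "\<dots> = (\<Sum>i\<in>I. \<integral>\<^sup>+z. w i (fst z) * indicator A z \<partial>\<pi>)"
      by (intro sum.cong nn_integral_cong) (auto simp: w_def)
    also have "\<dots> = (\<integral>\<^sup>+z. (\<Sum>i\<in>I. w i (fst z)) * indicator A z \<partial>\<pi>)"
      by (subst nn_integral_sum[symmetric]) (auto simp: sum_distrib_right)
    also have "\<dots> = (\<integral>\<^sup>+z. indicator A z \<partial>\<pi>)"
      using AE\<pi> by (intro nn_integral_cong_AE) (auto elim!: eventually_mono simp: w_sum)
    also have "\<dots> = emeasure \<pi> A" by simp
    finally show "emeasure (distr \<rho> (borel \<Otimes>\<^sub>M borel) (\<lambda>(i, y). (v i, y))) A = emeasure \<pi> A" .
  qed (simp add: \<open>sets \<pi> = _\<close>)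
  have "prob_space (distr \<rho> (count_space I) fst)"
    unfolding fst\<rho> using I by (intro prob_space_uniform_count_measure)
  then have "prob_space \<rho>"
    by (rule prob_space_distrD[rotated]) simp
  from that[OF this sets\<rho>[unfolded I_def] fst\<rho>[unfolded I_def] map\<rho>] show thesis .
qed

section \<open>Wasserstein bounds for perturbed empirical distributions\<close>

text \<open>A triangle inequality. Lifting the coupling to the index takes the place of gluing two
  couplings: a pair \<open>(i, y)\<close> determines \<open>v i\<close> and \<open>u i\<close>, so a
  single measure carries all three points.\<close>

lemma wasserstein_empirical_le:
  fixes u v :: "nat \<Rightarrow> 'y::euclidean_space"
  assumes n: "n \<ge> 1" and p: "p \<ge> 1" and st: "0 < s" "0 < t"
    and W: "wasserstein p (empirical n v) Q < ennreal s"
    and uv: "(\<Sum>i=1..n. norm (v i - u i) powr p) / real n \<le> t powr p"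
  shows "wasserstein p Q (empirical n u) \<le> ennreal (s + t)"
proof -
  define m where "m = (INF \<pi>\<in>couplings (empirical n v) Q.
    \<integral>\<^sup>+(y1, y2). ennreal (norm (y1 - y2) powr p) \<partial>\<pi>)"
  have "m < ennreal (s powr p)"
  proof -
    \<comment> \<open>\<open>enn2real\<close> sends infinity to 0, so finiteness has to be settled
      before the real value of \<open>m\<close> says anything about the cost.\<close>
    have "m \<noteq> \<infinity>"
      using W unfolding wasserstein_def m_def[symmetric] by auto
    moreover from this have "enn2real m powr (1 / p) < s"
      using W st unfolding wasserstein_def m_def[symmetric] by (simp add: ennreal_less_iff)
    then have "(enn2real m powr (1 / p)) powr p < s powr p"
      using p st by (intro powr_less_mono2) auto
    then have "enn2real m < s powr p"
      using p by (simp add: powr_powr)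
    ultimately show ?thesis
      by (metis ennreal_enn2real ennreal_lessI enn2real_nonneg infinity_ennreal_def
          less_top order_le_less_trans)
  qed
  \<comment> \<open>An infimum strictly below the bound is undercut by an actual coupling, whether
    or not it is attained; this is where the strictness of \<open>W\<close> enters.\<close>
  then obtain \<pi> where \<pi>: "\<pi> \<in> couplings (empirical n v) Q"
      and cost: "(\<integral>\<^sup>+(y1, y2). ennreal (norm (y1 - y2) powr p) \<partial>\<pi>) < ennreal (s powr p)"
    unfolding m_def INF_less_iff by blast
  define I where "I = {1..n}"
  have I: "finite I" "card I = n" by (auto simp: I_def)
  obtain \<rho> where "prob_space \<rho>" and sets\<rho>[measurable_cong]: "sets \<rho> = sets (count_space I \<Otimes>\<^sub>M borel)"
    and fst\<rho>: "distr \<rho> (count_space I) fst = uniform_count_measure I"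
    and map\<rho>: "distr \<rho> (borel \<Otimes>\<^sub>M borel) (\<lambda>(i, y). (v i, y)) = \<pi>"
    using coupling_empirical_index[OF n \<pi>] unfolding I_def .
  interpret \<rho>: prob_space \<rho> by fact
  have [measurable]: "u \<in> count_space I \<rightarrow>\<^sub>M borel" "v \<in> count_space I \<rightarrow>\<^sub>M borel"
    by simp_all
  have "(\<integral>\<^sup>+z. ennreal (norm (v (fst z) - snd z) powr p) \<partial>\<rho>)
      = (\<integral>\<^sup>+(y1, y2). ennreal (norm (y1 - y2) powr p) \<partial>\<pi>)"
    unfolding map\<rho>[symmetric] by (subst nn_integral_distr) (auto simp: split_beta')
  with cost have cost1: "(\<integral>\<^sup>+z. ennreal (norm (v (fst z) - snd z) powr p) \<partial>\<rho>) \<le> ennreal (s powr p)"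
    by simp
  have "(\<integral>\<^sup>+z. ennreal (norm (v (fst z) - u (fst z)) powr p) \<partial>\<rho>)
      = (\<integral>\<^sup>+i. ennreal (norm (v i - u i) powr p) \<partial>uniform_count_measure I)"
    unfolding fst\<rho>[symmetric] by (subst nn_integral_distr) auto
  also have "\<dots> = ennreal ((\<Sum>i\<in>I. norm (v i - u i) powr p) / real n)"
    using I by (simp add: nn_integral_uniform_count_measure_ennreal)
  also have "\<dots> \<le> ennreal (t powr p)"
    using uv unfolding I_def by (rule ennreal_leI)
  finally have cost2: "(\<integral>\<^sup>+z. ennreal (norm (v (fst z) - u (fst z)) powr p) \<partial>\<rho>) \<le> ennreal (t powr p)" .
  \<comment> \<open>The coordinates are swapped: concentration is stated from the sample to
    \<open>Q\<close>, the ball from \<open>Q\<close> to the sample.\<close>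
  define \<pi>' where "\<pi>' = distr \<rho> (borel \<Otimes>\<^sub>M borel) (\<lambda>(i, y). (y, u i))"
  have Q: "distr \<pi> borel snd = Q" using \<pi> by (simp add: couplings_def)
  have "\<pi>' \<in> couplings Q (empirical n u)"
    unfolding couplings_def mem_Collect_eq
  proof (intro conjI)
    show "prob_space \<pi>'"
      unfolding \<pi>'_def by (rule \<rho>.prob_space_distr) simp
    show "distr \<pi>' borel fst = Q"
      unfolding Q[symmetric] map\<rho>[symmetric] \<pi>'_def
      by (simp add: distr_distr comp_def split_beta')
    have "distr \<pi>' borel snd = distr (distr \<rho> (count_space I) fst) borel u"
      unfolding \<pi>'_def by (simp add: distr_distr comp_def split_beta')
    then show "distr \<pi>' borel snd = empirical n u"
      by (simp only: fst\<rho> empirical_def flip: I_def)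
  qed (simp add: \<pi>'_def)
  define m' where "m' = (INF \<pi>\<in>couplings Q (empirical n u).
    \<integral>\<^sup>+(y1, y2). ennreal (norm (y1 - y2) powr p) \<partial>\<pi>)"
  from \<open>\<pi>' \<in> _\<close> have "(INF \<pi>\<in>couplings Q (empirical n u). \<integral>\<^sup>+(y1, y2). ennreal (norm (y1 - y2) powr p) \<partial>\<pi>)
      \<le> (\<integral>\<^sup>+(y1, y2). ennreal (norm (y1 - y2) powr p) \<partial>\<pi>')"
    by (rule INF_lower)
  also have "\<dots> = (\<integral>\<^sup>+z. ennreal (norm (snd z - u (fst z)) powr p) \<partial>\<rho>)"
    unfolding \<pi>'_def by (subst nn_integral_distr) (auto simp: split_beta')
  also have "\<dots> \<le> (\<integral>\<^sup>+z. ennreal ((norm (v (fst z) - snd z) + norm (v (fst z) - u (fst z))) powr p) \<partial>\<rho>)"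
  proof (intro nn_integral_mono ennreal_leI powr_mono2)
    show "norm (snd z - u (fst z)) \<le> norm (v (fst z) - snd z) + norm (v (fst z) - u (fst z))" for z
      using norm_triangle_ineq4[of "v (fst z) - u (fst z)" "v (fst z) - snd z"] by (simp add: add.commute)
  qed (use p in auto)
  also have "\<dots> \<le> ennreal ((s + t) powr p)"
    by (intro nn_integral_Minkowski p st cost1 cost2) auto
  finally have le: "m' \<le> ennreal ((s + t) powr p)"
    unfolding m'_def .
  then have "m' \<noteq> \<infinity>"
    by (auto simp: top_unique)
  moreover have "enn2real m' powr (1 / p) \<le> ((s + t) powr p) powr (1 / p)"
    using le p st by (intro powr_mono2 enn2real_leI) auto
  ultimately show ?thesis
    using p st unfolding wasserstein_def m'_def[symmetric]
    by (simp add: powr_powr ennreal_leI del: ennreal_plus)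
qed

text \<open>In the application \<open>b\<close> is the regression error at the new covariate, and
  \<open>e i\<close> is the error at the \<open>i\<close>-th observation with the opposite sign.
  Each is controlled by \<open>k\<close>, which accounts for the term \<open>2 * k\<close>.\<close>

lemma wasserstein_residuals_le:
  fixes S :: "'y::euclidean_space set" and v e :: "nat \<Rightarrow> 'y"
  assumes n: "n \<ge> 1" and p: "p \<ge> 1" and sk: "0 < s" "0 < k"
    and S: "closed S" "convex S" "S \<noteq> {}" and v: "\<And>i. i \<in> {1..n} \<Longrightarrow> v i \<in> S"
    and W: "wasserstein p (empirical n v) Q < ennreal s"
    and b: "norm b powr p \<le> k powr p"
    and e: "1 / real n * (\<Sum>i=1..n. norm (e i) powr p) \<le> k powr p"
  shows "wasserstein p Q (empirical n (\<lambda>i. closest_point S (v i + b + e i))) \<le> ennreal (2 * k + s)"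
proof -
  let ?U = "uniform_count_measure {1..n}"
  have U: "(\<integral>\<^sup>+i. ennreal (h i powr p) \<partial>?U) = ennreal ((\<Sum>i=1..n. h i powr p) / real n)" for h
    by (simp add: nn_integral_uniform_count_measure_ennreal)
  have "norm (v i - closest_point S (v i + b + e i)) \<le> norm b + norm (e i)" if "i \<in> {1..n}" for i
  proof -
    have "dist (closest_point S (v i)) (closest_point S (v i + b + e i)) \<le> dist (v i) (v i + b + e i)"
      by (rule closest_point_lipschitz) (use S in auto)
    also have "\<dots> = norm (b + e i)"
      by (metis add.assoc add_diff_cancel_left' dist_norm norm_minus_commute)
    finally show ?thesis
      using v[OF that] norm_triangle_ineq[of b "e i"] by (simp add: closest_point_self dist_norm)
  qed
  then have "(\<Sum>i=1..n. norm (v i - closest_point S (v i + b + e i)) powr p)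
      \<le> (\<Sum>i=1..n. (norm b + norm (e i)) powr p)"
    using p by (intro sum_mono powr_mono2) auto
  \<comment> \<open>Minkowski's inequality on the index set, with \<open>norm b\<close> as a
    constant function; averaging over a probability measure preserves its bound.\<close>
  moreover have "(\<integral>\<^sup>+i. ennreal ((norm b + norm (e i)) powr p) \<partial>?U) \<le> ennreal ((k + k) powr p)"
    using n b e
    by (intro nn_integral_Minkowski p sk)
      (auto simp: U ennreal_leI measurable_def sets_uniform_count_measure space_uniform_count_measure
        simp del: One_nat_def nn_integral_const)
  then have "(\<Sum>i=1..n. (norm b + norm (e i)) powr p) / real n \<le> (k + k) powr p"
    by (simp add: U del: One_nat_def)
  ultimately have "(\<Sum>i=1..n. norm (v i - closest_point S (v i + b + e i)) powr p) / real n
      \<le> (k + k) powr p"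
    by (meson divide_right_mono of_nat_0_le_iff order_trans)
  then have "wasserstein p Q (empirical n (\<lambda>i. closest_point S (v i + b + e i))) \<le> ennreal (s + (k + k))"
    using n p sk W by (intro wasserstein_empirical_le) auto
  then show ?thesis by (simp add: algebra_simps)
qed

section \<open>The concentration radius\<close>

text \<open>In each branch the exponents of \<open>kappa2\<close> and \<open>conc_bound\<close> are
  reciprocal, and \<open>kappa2\<close> is at most 1 exactly when its base \<open>r\<close> is, so
  the branches match. The base is positive because \<open>2 * C / \<alpha>\<close> exceeds
  1.\<close>

lemma
  assumes "p \<ge> 1" "a > p" "d \<ge> 1" "C \<ge> 1" "c\<^sub>0 > 0" "n \<ge> 1" "0 < \<alpha>" "\<alpha> < 1"
  shows kappa2_pos: "kappa2 p a d C c\<^sub>0 n \<alpha> > 0"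
    and conc_bound_kappa2: "conc_bound p a d C c\<^sub>0 n (kappa2 p a d C c\<^sub>0 n \<alpha>) = \<alpha> / 2"
proof -
  define L where "L = ln (2 * C / \<alpha>)"
  define r where "r = L / (c\<^sub>0 * real n)"
  have "2 * C / \<alpha> > 1"
    using assms by (simp add: field_simps)
  then have "L > 0" "exp L = 2 * C / \<alpha>"
    by (auto simp: L_def)
  then have L: "L > 0" "C * exp (- L) = \<alpha> / 2"
    using assms by (auto simp: exp_minus)
  have r: "r > 0" "c\<^sub>0 * (real n * r) = L" "real n \<ge> L / c\<^sub>0 \<longleftrightarrow> r \<le> 1"
    using assms L by (simp_all add: r_def pos_divide_le_eq mult.commute)
  have kappa: "kappa2 p a d C c\<^sub>0 n \<alpha> = (if r \<le> 1 then r powr min (p / d) (1 / 2) else r powr (p / a))"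
    unfolding kappa2_def L_def[symmetric] r(3) r_def ..
  show "kappa2 p a d C c\<^sub>0 n \<alpha> > 0"
    using r by (simp add: kappa)
  have exponents: "min (p / d) (1 / 2) * max (real d / p) 2 = 1"
  proof (cases "p / d \<le> 1 / 2")
    case True
    then have "real d / p \<ge> 2"
      using assms by (simp add: field_simps)
    with True show ?thesis
      using assms by simp
  next
    case False
    then have "real d / p \<le> 2"
      using assms by (simp add: field_simps)
    with False show ?thesis by simp
  qed
  show "conc_bound p a d C c\<^sub>0 n (kappa2 p a d C c\<^sub>0 n \<alpha>) = \<alpha> / 2"
  proof (cases "r \<le> 1")
    case True
    have "r powr min (p / d) (1 / 2) \<le> 1"
      using True r assms by (intro powr_le1) auto
    then show ?thesis
      using True r L unfolding conc_bound_def kappa by (simp add: powr_powr exponents mult.assoc)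
  next
    case False
    then have "r powr (p / a) > 1"
      using assms by (intro gr_one_powr) auto
    then have big: "\<not> r powr (p / a) \<le> 1"
      by linarith
    show ?thesis
      using r L assms unfolding conc_bound_def kappa if_not_P[OF False] if_not_P[OF big] by (simp add: powr_powr mult.assoc)
  qed
qed

section \<open>Measurability under lower semicontinuity\<close>

text \<open>Lower semicontinuity makes every set \<open>r < f\<close> open relative to
  \<open>S\<close>; \<open>V\<close> is the largest open set whose trace on \<open>S\<close> lies in
  it. The lemma serves to make the true cost of the data-driven decision a random variable.\<close>

lemma lsc_on_compose_measurable:
  fixes f :: "'a::topological_space \<Rightarrow> real"
  assumes f: "lsc_on S f" and S: "S \<in> sets borel"
    and h: "h \<in> borel_measurable M" "\<And>\<omega>. \<omega> \<in> space M \<Longrightarrow> h \<omega> \<in> S"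
  shows "(\<lambda>\<omega>. f (h \<omega>)) \<in> borel_measurable M"
  unfolding borel_measurable_iff_greater
proof
  fix r
  define V where "V = \<Union>{U. open U \<and> (\<forall>y\<in>U \<inter> S. r < f y)}"
  have "x \<in> V" if "x \<in> S" "r < f x" for x
  proof -
    have "\<forall>\<^sub>F y in at x within S. r < f y"
      using f that by (auto simp: lsc_on_def)
    then obtain U where "open U" "x \<in> U" "\<forall>y\<in>U. y \<noteq> x \<longrightarrow> y \<in> S \<longrightarrow> r < f y"
      unfolding eventually_at_topological by blast
    \<comment> \<open>\<open>at x within S\<close> omits \<open>x\<close> itself, where the
      inequality holds by assumption.\<close>
    moreover from this have "\<forall>y\<in>U \<inter> S. r < f y"
      using that by auto
    ultimately show ?thesis
      unfolding V_def by auto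
  qed
  then have "{\<omega> \<in> space M. r < f (h \<omega>)} = h -` (V \<inter> S) \<inter> space M"
    using h(2) by (auto simp: V_def)
  moreover have "open V"
    by (auto simp: V_def)
  ultimately show "{\<omega> \<in> space M. r < f (h \<omega>)} \<in> sets M"
    using S h(1) by (simp add: measurable_sets del: vimage_Int)
qed

section \<open>Worst-case expectations and the optimal value\<close>

lemma ext_expectation_eq_integral:
  assumes "integrable Q h"
  shows "ext_expectation Q h = ereal (\<integral>y. h y \<partial>Q)"
proof -
  have "enn2ereal x = ereal (enn2real x)" if "x \<noteq> \<infinity>" for x
    using that by (cases x) auto
  then show ?thesis
    using assms unfolding real_integrable_def
    by (simp add: ext_expectation_def real_lebesgue_integral_def[OF assms])
qed

lemma is_dro_solution_value:
  assumes "is_dro_solution p S c Z P \<zeta> z"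
  shows "dro_value p S c Z P \<zeta> = dro_objective p S c P \<zeta> z"
  using assms unfolding is_dro_solution_def dro_value_def
  by (intro antisym INF_lower INF_greatest) auto

lemma integral_le_dro_objective:
  assumes "Q \<in> wasserstein_ball p S P \<zeta>" "integrable Q (c z)"
  shows "ereal (\<integral>y. c z y \<partial>Q) \<le> dro_objective p S c P \<zeta> z"
  unfolding dro_objective_def ext_expectation_eq_integral[OF assms(2), symmetric]
  by (rule SUP_upper) fact

section \<open>Independence and product laws\<close>

text \<open>The library's \<open>indep_var_distribution_eq\<close> requires both random variables to have the same type.\<close>

lemma (in prob_space) distr_pair_indep_set:
  assumes X [measurable]: "X \<in> M \<rightarrow>\<^sub>M S" and Y [measurable]: "Y \<in> M \<rightarrow>\<^sub>M T"
    and indep: "indep_set {X -` A \<inter> space M | A. A \<in> sets S} {Y -` B \<inter> space M | B. B \<in> sets T}"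
  shows "distr M S X \<Otimes>\<^sub>M distr M T Y = distr M (S \<Otimes>\<^sub>M T) (\<lambda>\<omega>. (X \<omega>, Y \<omega>))"
proof (rule pair_measure_eqI)
  show "sigma_finite_measure (distr M S X)" "sigma_finite_measure (distr M T Y)"
    by (auto intro!: prob_space_distr prob_space_imp_sigma_finite)
next
  fix A B assume "A \<in> sets (distr M S X)" "B \<in> sets (distr M T Y)"
  then have [measurable]: "A \<in> sets S" "B \<in> sets T" by auto
  have "prob ((X -` A \<inter> space M) \<inter> (Y -` B \<inter> space M))
      = prob (X -` A \<inter> space M) * prob (Y -` B \<inter> space M)"
    by (rule indep_setD[OF indep]) auto
  moreover have "(X -` A \<inter> space M) \<inter> (Y -` B \<inter> space M) = (\<lambda>\<omega>. (X \<omega>, Y \<omega>)) -` (A \<times> B) \<inter> space M"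
    by auto
  ultimately show "emeasure (distr M S X) A * emeasure (distr M T Y) B
      = emeasure (distr M (S \<Otimes>\<^sub>M T) (\<lambda>\<omega>. (X \<omega>, Y \<omega>))) (A \<times> B)"
    by (simp add: emeasure_distr emeasure_eq_measure ennreal_mult[symmetric])
qed simp

section \<open>The finite sample certificate\<close>

theorem theorem7:
  fixes M :: "'w measure"
    and X :: "'w \<Rightarrow> 'x::euclidean_space" and Y eps :: "'w \<Rightarrow> 'y::euclidean_space"
    and fstar :: "'x \<Rightarrow> 'y"
    and PX :: "'x measure" and Peps :: "'y measure"
    and \<X> :: "'x set" and \<Y> :: "'y set" and \<Z> :: "'z::euclidean_space set"
    and c :: "'z \<Rightarrow> 'y \<Rightarrow> real" and g :: "'z \<Rightarrow> 'x \<Rightarrow> real"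
    and xs :: "nat \<Rightarrow> 'w \<Rightarrow> 'x" and ys epss :: "nat \<Rightarrow> 'w \<Rightarrow> 'y"
    and n :: nat
    and regress :: "(nat \<Rightarrow> 'y \<times> 'x) \<Rightarrow> 'x \<Rightarrow> 'y" and fhat :: "'w \<Rightarrow> 'x \<Rightarrow> 'y"
    and epshat :: "nat \<Rightarrow> 'w \<Rightarrow> 'y"
    and Pstar :: "nat \<Rightarrow> 'w \<Rightarrow> 'x \<Rightarrow> 'y measure" and PER :: "'w \<Rightarrow> 'x \<Rightarrow> 'y measure"
    and p a C c\<^sub>0 \<alpha> :: real
    and \<kappa> :: "real \<Rightarrow> 'x \<Rightarrow> real" and \<zeta> :: "'x \<Rightarrow> real"
    and vDRO :: "'w \<Rightarrow> 'x \<Rightarrow> ereal" and zDRO :: "'w \<Rightarrow> 'x \<Rightarrow> 'z"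
    \<comment> \<open>the model\<close>
  assumes M: "prob_space M"
    and X: "X \<in> borel_measurable M" and eps: "eps \<in> borel_measurable M"
    and fstar: "fstar \<in> borel_measurable borel"
    and Y: "\<And>\<omega>. Y \<omega> = fstar (X \<omega>) + eps \<omega>"
    and eps_indep: "prob_space.indep_set M
      {X -` A \<inter> space M | A. A \<in> sets borel} {eps -` B \<inter> space M | B. B \<in> sets borel}"
    and eps_mean: "integrable M eps" "(\<integral>\<omega>. eps \<omega> \<partial>M) = 0"
    and PX: "PX = distr M borel X" and Peps: "Peps = distr M borel eps"
    and supp_X: "\<X> = msupport PX"
    and supp_Y: "\<Y> = msupport (distr M borel Y)" "\<Y> \<noteq> {}" "convex \<Y>"
    \<comment> \<open>the decision problem\<close>
    and Z: "\<Z> \<noteq> {}" "compact \<Z>"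
    and c_meas: "\<And>z. z \<in> \<Z> \<Longrightarrow> c z \<in> borel_measurable borel"
    and c_int: "AE x in PX. \<forall>z\<in>\<Z>. integrable Peps (\<lambda>e. c z (fstar x + e))"
    and g: "\<And>z x. g z x = (\<integral>e. c z (fstar x + e) \<partial>Peps)"
    and g_lsc: "AE x in PX. lsc_on \<Z> (\<lambda>z. g z x)"
    \<comment> \<open>the data\<close>
    and n: "n \<ge> 1"
    and data_meas: "\<And>i. i \<ge> 1 \<Longrightarrow> xs i \<in> borel_measurable M"
      "\<And>i. i \<ge> 1 \<Longrightarrow> ys i \<in> borel_measurable M"
    and data_law: "\<And>i. i \<ge> 1 \<Longrightarrow>
      distr M (borel \<Otimes>\<^sub>M borel) (\<lambda>\<omega>. (ys i \<omega>, xs i \<omega>))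
        = distr M (borel \<Otimes>\<^sub>M borel) (\<lambda>\<omega>. (Y \<omega>, X \<omega>))"
    and epss: "\<And>i \<omega>. epss i \<omega> = ys i \<omega> - fstar (xs i \<omega>)"
    and regress_meas: "(\<lambda>(D, x). regress D x) \<in> borel_measurable
      ((\<Pi>\<^sub>M i\<in>{1..n}. borel \<Otimes>\<^sub>M borel) \<Otimes>\<^sub>M borel)"
    and fhat: "\<And>\<omega> x. fhat \<omega> x = regress (\<lambda>i\<in>{1..n}. (ys i \<omega>, xs i \<omega>)) x"
    and epshat: "\<And>i \<omega>. epshat i \<omega> = ys i \<omega> - fhat \<omega> (xs i \<omega>)"
    and Pstar: "\<And>m \<omega> x. Pstar m \<omega> x = empirical m (\<lambda>i. fstar x + epss i \<omega>)"
    and PER: "\<And>\<omega> x. PER \<omega> x = empirical n (\<lambda>i. closest_point \<Y> (fhat \<omega> x + epshat i \<omega>))"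
    \<comment> \<open>the hypotheses (i), (ii), (iii)\<close>
    and p: "p \<ge> 1" "p \<noteq> real DIM('y) / 2"
    and light_tail: "a > p" "integrable M (\<lambda>\<omega>. exp (norm (eps \<omega>) powr a))"
    and finite_sample: "AE x in PX. \<forall>\<beta>\<in>{0<..<1}. \<kappa> \<beta> x > 0 \<and>
      measure M {\<omega> \<in> space M. norm (fstar x - fhat \<omega> x) powr p > \<kappa> \<beta> x powr p} \<le> \<beta> \<and>
      measure M {\<omega> \<in> space M.
        1 / real n * (\<Sum>i=1..n. norm (fstar (xs i \<omega>) - fhat \<omega> (xs i \<omega>)) powr p)
          > \<kappa> \<beta> x powr p} \<le> \<beta>"
    and eps_iid: "prob_space.indep_vars M (\<lambda>_. borel) epss {1..n}"
      "\<And>i. i \<in> {1..n} \<Longrightarrow> distr M borel (epss i) = Peps"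
    \<comment> \<open>the constants of the measure concentration inequality\<close>
    and conc_const: "C \<ge> 1" "c\<^sub>0 > 0"
    and conc_meas: "\<And>m x. m \<ge> 1 \<Longrightarrow> x \<in> \<X> \<Longrightarrow>
      (\<lambda>\<omega>. wasserstein p (Pstar m \<omega> x) (cond_law Peps fstar x)) \<in> borel_measurable M"
    and conc: "\<And>t m x. t > 0 \<Longrightarrow> m \<ge> 1 \<Longrightarrow> x \<in> \<X> \<Longrightarrow>
      measure M {\<omega> \<in> space M. wasserstein p (Pstar m \<omega> x) (cond_law Peps fstar x) \<ge> ennreal t}
        \<le> conc_bound p a DIM('y) C c\<^sub>0 m t"
    \<comment> \<open>the Wasserstein ER-DRO problem\<close>
    and \<alpha>: "0 < \<alpha>" "\<alpha> < 1"
    and \<zeta>: "\<And>x. \<zeta> x = 2 * \<kappa> (\<alpha> / 4) x + kappa2 p a DIM('y) C c\<^sub>0 n \<alpha>"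
    and objective: "AE x in PX. \<forall>\<omega>\<in>space M.
      (\<forall>z\<in>\<Z>. \<bar>dro_objective p \<Y> c (PER \<omega> x) (\<zeta> x) z\<bar> \<noteq> \<infinity>) \<and>
      lsc_on \<Z> (dro_objective p \<Y> c (PER \<omega> x) (\<zeta> x))"
    and vDRO: "\<And>\<omega> x. vDRO \<omega> x = dro_value p \<Y> c \<Z> (PER \<omega> x) (\<zeta> x)"
    and vDRO_meas: "AE x in PX. (\<lambda>\<omega>. vDRO \<omega> x) \<in> borel_measurable M"
    and zDRO: "AE x in PX. \<forall>\<omega>\<in>space M. is_dro_solution p \<Y> c \<Z> (PER \<omega> x) (\<zeta> x) (zDRO \<omega> x)"
    and zDRO_meas: "AE x in PX. (\<lambda>\<omega>. zDRO \<omega> x) \<in> borel_measurable M"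
  shows "AE x in PX. measure M {\<omega> \<in> space M. ereal (g (zDRO \<omega> x) x) \<le> vDRO \<omega> x} \<ge> 1 - \<alpha>"
proof -
  interpret prob_space M by fact
  note [measurable] = X eps fstar
  have sets_Peps [measurable_cong]: "sets Peps = sets borel"
    and sets_PX [measurable_cong]: "sets PX = sets borel"
    by (simp_all add: Peps PX)
  interpret Peps: prob_space Peps
    unfolding Peps by (rule prob_space_distr) simp
  interpret PX: prob_space PX
    unfolding PX by (rule prob_space_distr) simp
  interpret P: pair_prob_space PX Peps ..
  have Y_meas [measurable]: "Y \<in> borel_measurable M"
    unfolding Y[abs_def] by simp
  have closed_\<Y>: "closed \<Y>"
    unfolding supp_Y(1) by (rule closed_msupport)
  then have [measurable]: "\<Y> \<in> sets borel" by simp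
  \<comment> \<open>By independence, the almost sure membership of \<open>Y\<close> in its support
    becomes an almost everywhere statement on a product measure, which can be sectioned at
    \<open>x\<close>.\<close>
  have joint: "PX \<Otimes>\<^sub>M Peps = distr M (borel \<Otimes>\<^sub>M borel) (\<lambda>\<omega>. (X \<omega>, eps \<omega>))"
    unfolding PX Peps by (rule distr_pair_indep_set) (use X eps eps_indep in auto)
  have "AE y in distr M borel Y. y \<in> \<Y>"
    unfolding supp_Y(1) by (rule AE_in_msupport) simp
  then have "AE \<omega> in M. fstar (X \<omega>) + eps \<omega> \<in> \<Y>"
    by (subst (asm) AE_distr_iff) (auto simp: Y)
  then have "AE z in PX \<Otimes>\<^sub>M Peps. fstar (fst z) + snd z \<in> \<Y>"
    unfolding joint by (subst AE_distr_iff) auto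
  then have in_\<Y>: "AE x in PX. AE e in Peps. fstar x + e \<in> \<Y>"
    by (auto dest: P.AE_pair)
  have in_\<X>: "AE x in PX. x \<in> \<X>"
    unfolding supp_X by (rule AE_in_msupport) (rule sets_PX)
  show ?thesis
    using in_\<Y> in_\<X> c_int g_lsc finite_sample vDRO_meas zDRO zDRO_meas
  proof eventually_elim
    \<comment> \<open>From here on \<open>x\<close> is fixed outside a null set that depends on none
      of \<open>\<omega>\<close>, \<open>\<beta>\<close> and \<open>z\<close>.\<close>
    case (elim x)
    define k where "k = \<kappa> (\<alpha> / 4) x"
    define s where "s = kappa2 p a DIM('y) C c\<^sub>0 n \<alpha>"
    have k: "k > 0" using elim(5) \<alpha> by (auto simp: k_def)
    have s: "s > 0"
      unfolding s_def using p light_tail conc_const n \<alpha> by (intro kappa2_pos) auto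
    define Q where "Q = cond_law Peps fstar x"
    have Q: "Q \<in> probs_on \<Y>"
    proof -
      have "prob_space Q"
        unfolding Q_def cond_law_def by (rule Peps.prob_space_distr) simp
      moreover have "AE y in Q. y \<in> \<Y>"
        unfolding Q_def cond_law_def using elim(1) by (subst AE_distr_iff) auto
      moreover have "sets Q = sets borel"
        by (simp add: Q_def cond_law_def)
      ultimately show ?thesis
        by (simp add: probs_on_def prob_space.emeasure_eq_1_AE)
    qed
    have c_int_Q: "integrable Q (c z)" "(\<integral>y. c z y \<partial>Q) = g z x" if "z \<in> \<Z>" for z
      using elim(3) c_meas[OF that] that
      by (auto simp: Q_def cond_law_def g integrable_distr_eq integral_distr)

    have data [measurable]: "(\<lambda>\<omega>. \<lambda>i\<in>{1..n}. (ys i \<omega>, xs i \<omega>)) \<in> M \<rightarrow>\<^sub>M (\<Pi>\<^sub>M i\<in>{1..n}. borel \<Otimes>\<^sub>M borel)"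
      by (intro measurable_restrict measurable_Pair data_meas) auto
    \<comment> \<open>The estimate is also evaluated at the random points \<open>xs i\<close>, which
      are part of its own data; hence the use of joint measurability of
      \<open>regress\<close>.\<close>
    have fhat_meas: "(\<lambda>\<omega>. fhat \<omega> (h \<omega>)) \<in> borel_measurable M" if "h \<in> borel_measurable M" for h
      using measurable_compose[OF measurable_Pair[OF data that] regress_meas] by (simp add: fhat)
    have [measurable]: "(\<lambda>\<omega>. fhat \<omega> x) \<in> borel_measurable M"
      by (rule fhat_meas) simp
    have [measurable]: "xs i \<in> borel_measurable M" "ys i \<in> borel_measurable M"
      "(\<lambda>\<omega>. fhat \<omega> (xs i \<omega>)) \<in> borel_measurable M" "epss i \<in> borel_measurable M" if "i \<in> {1..n}" for i
      using that data_meas[of i] fhat_meas[of "xs i"] unfolding epss[abs_def] by auto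

    define good where "good = {\<omega> \<in> space M. ereal (g (zDRO \<omega> x) x) \<le> vDRO \<omega> x}"
    \<comment> \<open>The four failures and their budget: concentration
      (\<open>\<alpha> / 2\<close>), error at \<open>x\<close> (\<open>\<alpha> / 4\<close>), mean
      error over the observations (\<open>\<alpha> / 4\<close>), and a point
      \<open>fstar x + epss i \<omega>\<close> outside \<open>\<Y>\<close> (probability 0).\<close>
    define B1 where "B1 = {\<omega> \<in> space M. wasserstein p (Pstar n \<omega> x) Q \<ge> ennreal s}"
    define B2 where "B2 = {\<omega> \<in> space M. norm (fstar x - fhat \<omega> x) powr p > k powr p}"
    define B3 where "B3 = {\<omega> \<in> space M.
      1 / real n * (\<Sum>i=1..n. norm (fstar (xs i \<omega>) - fhat \<omega> (xs i \<omega>)) powr p) > k powr p}"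
    define B4 where "B4 = {\<omega> \<in> space M. \<exists>i\<in>{1..n}. fstar x + epss i \<omega> \<notin> \<Y>}"
    have Z_borel: "\<Z> \<in> sets borel"
      using Z by (intro borel_closed compact_imp_closed)
    \<comment> \<open>\<open>good\<close> must be an event for the bound on its complement to yield
      one on \<open>good\<close> itself.\<close>
    have "(\<lambda>\<omega>. g (zDRO \<omega> x) x) \<in> borel_measurable M"
      using elim(4) Z_borel elim(8) by (rule lsc_on_compose_measurable)
        (use elim(7) in \<open>auto simp: is_dro_solution_def\<close>)
    then have good: "good \<in> events"
      unfolding good_def using elim(6) by measurable
    have "B1 \<in> events"
      unfolding B1_def Q_def using conc_meas[OF n elim(2)] by measurable
    moreover have "B2 \<in> events"
      unfolding B2_def by measurable
    moreover have "B3 \<in> events"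
      unfolding B3_def by measurable
    moreover have "B4 \<in> events"
      unfolding B4_def by measurable
    ultimately have B: "B1 \<in> events" "B2 \<in> events" "B3 \<in> events" "B4 \<in> events" by auto
    have "prob B1 \<le> \<alpha> / 2"
      using conc[OF s n elim(2)] conc_bound_kappa2[of p a "DIM('y)" C c\<^sub>0 n \<alpha>]
        p light_tail conc_const n \<alpha> by (simp add: B1_def Q_def s_def)
    moreover have "prob B2 \<le> \<alpha> / 4" "prob B3 \<le> \<alpha> / 4"
      using bspec[OF elim(5), of "\<alpha> / 4"] \<alpha> unfolding B2_def B3_def k_def by simp_all
    \<comment> \<open>Each \<open>epss i\<close> has law \<open>Peps\<close>, so the almost
      everywhere statement about the noise transfers to finitely many sample errors.\<close>
    moreover have "prob B4 = 0"
    proof -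
      have "AE \<omega> in M. \<forall>i\<in>{1..n}. fstar x + epss i \<omega> \<in> \<Y>"
      proof (intro AE_finite_allI)
        fix i assume i: "i \<in> {1..n}"
        have "AE e in distr M borel (epss i). fstar x + e \<in> \<Y>"
          unfolding eps_iid(2)[OF i] by (rule elim(1))
        then show "AE \<omega> in M. fstar x + epss i \<omega> \<in> \<Y>"
          using i by (subst (asm) AE_distr_iff) auto
      qed simp
      then show ?thesis
        unfolding prob_eq_0[OF B(4)] by eventually_elim (auto simp: B4_def)
    qed
    moreover have cover: "space M - good \<subseteq> B1 \<union> B2 \<union> B3 \<union> B4"
    proof (rule ccontr)
      assume "\<not> ?thesis"
      then obtain \<omega> where \<omega>: "\<omega> \<in> space M" "\<omega> \<notin> good" "\<omega> \<notin> B1" "\<omega> \<notin> B2" "\<omega> \<notin> B3" "\<omega> \<notin> B4"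
        by blast
      \<comment> \<open>The argument of the projection is split into an exact sample point of the
        law at \<open>x\<close> and two regression errors; the \<open>fstar\<close> terms cancel,
        leaving \<open>fhat \<omega> x + epshat i \<omega>\<close>.\<close>
      have "wasserstein p Q (empirical n (\<lambda>i. closest_point \<Y> ((fstar x + epss i \<omega>) + (fhat \<omega> x - fstar x)
          + (fstar (xs i \<omega>) - fhat \<omega> (xs i \<omega>))))) \<le> ennreal (2 * k + s)"
      proof (rule wasserstein_residuals_le[OF n p(1) s k closed_\<Y> supp_Y(3,2)])
        show "fstar x + epss i \<omega> \<in> \<Y>" if "i \<in> {1..n}" for i
          using \<omega> that by (simp add: B4_def)
        show "wasserstein p (empirical n (\<lambda>i. fstar x + epss i \<omega>)) Q < ennreal s"
          using \<omega> by (simp add: B1_def Pstar not_le)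
        show "norm (fhat \<omega> x - fstar x) powr p \<le> k powr p"
          using \<omega> by (simp add: B2_def not_less norm_minus_commute)
        show "1 / real n * (\<Sum>i=1..n. norm (fstar (xs i \<omega>) - fhat \<omega> (xs i \<omega>)) powr p) \<le> k powr p"
          using \<omega> by (simp add: B3_def not_less)
      qed
      also have "(\<lambda>i. closest_point \<Y> ((fstar x + epss i \<omega>) + (fhat \<omega> x - fstar x)
          + (fstar (xs i \<omega>) - fhat \<omega> (xs i \<omega>)))) = (\<lambda>i. closest_point \<Y> (fhat \<omega> x + epshat i \<omega>))"
        by (simp add: epss epshat algebra_simps)
      finally have "Q \<in> wasserstein_ball p \<Y> (PER \<omega> x) (\<zeta> x)"
        using Q by (simp add: wasserstein_ball_def PER \<zeta> k_def s_def)
      moreover have sol: "is_dro_solution p \<Y> c \<Z> (PER \<omega> x) (\<zeta> x) (zDRO \<omega> x)"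
        using elim(7) \<omega>(1) by blast
      moreover from sol have "zDRO \<omega> x \<in> \<Z>"
        by (simp add: is_dro_solution_def)
      ultimately have "ereal (g (zDRO \<omega> x) x) \<le> vDRO \<omega> x"
        using integral_le_dro_objective[of Q p \<Y> "PER \<omega> x" "\<zeta> x" c "zDRO \<omega> x"]
        by (simp add: c_int_Q vDRO is_dro_solution_value)
      with \<omega> show False by (simp add: good_def)
    qed
    moreover have "prob (space M - good) \<le> prob B1 + prob B2 + prob B3 + prob B4"
    proof -
      from cover have "prob (space M - good) \<le> prob (B1 \<union> B2 \<union> B3 \<union> B4)"
        using B by (intro finite_measure_mono) auto
      moreover have "prob (B1 \<union> B2 \<union> B3 \<union> B4) \<le> prob (B1 \<union> B2 \<union> B3) + prob B4"
        "prob (B1 \<union> B2 \<union> B3) \<le> prob (B1 \<union> B2) + prob B3" "prob (B1 \<union> B2) \<le> prob B1 + prob B2"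
        using B by (auto intro!: measure_Un_le)
      ultimately show ?thesis by linarith
    qed
    ultimately show ?case
      using prob_compl[OF good] by (simp add: good_def)
  qed
qed

end
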